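(* Let $A\in\mathcal{F}^{m\times n}$ and $b\in\mathcal{F}^m$ be such that the system $Ax=b$ is consistent (i.e. has at least one solution in $\mathcal{F}^n$). Let $M\in\mathcal{F}^{m\times m}$ be a nonsingular matrix such that the rows of $A'=MA$ form a quasi-orthonormal list of vectors, and put $b'=Mb$. Then for every $x_h\in\mathcal{F}^n$ with $Ax_h=0$, the vector $$x=(A')^*b'+x_h$$ is a solution of $Ax=b$.
   Context: $\mathcal{F}$ is a subfield of $\mathbb{C}$ closed under complex conjugation (for instance $\mathcal{F}=\mathbb{C}$), and $\mathcal{F}^k$ carries the standard inner product $\langle u,v\rangle=\sum_j u_j\overline{v_j}$ and the Euclidean norm $\|u\|=\sqrt{\langle u,u\rangle}$. The superscript $*$ denotes conjugate transpose. A list of vectors is quasi-orthonormal if each vector has norm $1$ or $0$ and the vectors of norm $1$ are mutually orthogonal. The row orthonormalization procedure (ROP) of the paper left-multiplies $A$ by a sequence of nonsingular $m\times m$ matrices $M_1,M_2,\dots$, with product $M=\cdots M_2M_1$, so that the rows of $A'=MA$ form a quasi-orthonormal list; the same operations applied to $b$ give $b'=Mb$. *)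

theory Defs
  imports
    "HOL-Algebra.Subrings"
    "Jordan_Normal_Form.Schur_Decomposition"
begin

text \<open>Dimensions may be 0. The inner product
  \<open>u \<bullet>c v\<close> is \<open>\<Sum>j. u\<^sub>j * cnj (v\<^sub>j)\<close>, linear in the first argument.\<close>

definition conj_closed_subfield :: "complex set \<Rightarrow> bool" where
  "conj_closed_subfield F \<longleftrightarrow>
     subfield F (class_ring :: complex ring) \<and> (\<forall>z\<in>F. cnj z \<in> F)"

definition vecs_over :: "complex set \<Rightarrow> nat \<Rightarrow> complex vec set" where
  "vecs_over F n = {v \<in> carrier_vec n. \<forall>i<n. v $ i \<in> F}"

definition mats_over :: "complex set \<Rightarrow> nat \<Rightarrow> nat \<Rightarrow> complex mat set" where
  "mats_over F m n = {A \<in> carrier_mat m n. \<forall>i<m. \<forall>j<n. A $$ (i, j) \<in> F}"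

text \<open>\<open>Re\<close> only changes the type here: \<open>v \<bullet>c v\<close> is a non-negative real.\<close>

definition euclid_norm :: "complex vec \<Rightarrow> real" where
  "euclid_norm v = sqrt (Re (v \<bullet>c v))"

text \<open>Orthogonality is required between distinct positions of the list, so a
  unit vector cannot occur twice.\<close>

definition quasi_orthonormal :: "complex vec list \<Rightarrow> bool" where
  "quasi_orthonormal vs \<longleftrightarrow>
     (\<forall>v\<in>set vs. euclid_norm v = 1 \<or> euclid_norm v = 0) \<and>
     (\<forall>i<length vs. \<forall>j<length vs. i \<noteq> j \<longrightarrow>
        euclid_norm (vs ! i) = 1 \<longrightarrow> euclid_norm (vs ! j) = 1 \<longrightarrow>
        vs ! i \<bullet>c vs ! j = 0)"

end

(* For a quasi-orthonormal list of rows, A' (A')* is the diagonal 0/1 matrix marking the nonzero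
   rows, so A' (A')* A' = A'. If A x0 = b then b' = A' x0, hence A' (A')* b' = A' x0 = b', and
   cancelling the nonsingular M gives A (A')* b' = b. *)

theory Submission
  imports Defs
begin

text \<open>These closure properties keep the constructed solution inside \<open>F\<close>: sums and
  products serve the matrix products, \<open>cnj\<close> serves the adjoint, and \<open>0\<close> is
  the value of an empty sum when a dimension is 0.\<close>

lemma conj_closed_subfieldD:
  assumes "conj_closed_subfield F"
  shows "0 \<in> F"
    and "a \<in> F \<Longrightarrow> b \<in> F \<Longrightarrow> a + b \<in> F"
    and "a \<in> F \<Longrightarrow> b \<in> F \<Longrightarrow> a * b \<in> F"
    and "a \<in> F \<Longrightarrow> cnj a \<in> F"
proof -
  have sf: "subfield F (class_ring :: complex ring)" and cj: "\<forall>z\<in>F. cnj z \<in> F"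
    using assms unfolding conj_closed_subfield_def by auto
  have sr: "subring F (class_ring :: complex ring)"
    by (rule subfieldE(1)[OF sf])
  show "0 \<in> F" using subringE(2)[OF sr] by (simp add: class_ring_simps)
  show "a \<in> F \<Longrightarrow> b \<in> F \<Longrightarrow> a + b \<in> F" using subringE(7)[OF sr] by (simp add: class_ring_simps)
  show "a \<in> F \<Longrightarrow> b \<in> F \<Longrightarrow> a * b \<in> F" using subringE(6)[OF sr] by (simp add: class_ring_simps)
  show "a \<in> F \<Longrightarrow> cnj a \<in> F" using cj by blast
qed

lemma conj_closed_subfield_sum:
  assumes "conj_closed_subfield F" and "\<And>i. i \<in> I \<Longrightarrow> f i \<in> F"
  shows "sum f I \<in> F"
  using assms(2)
  by (induction I rule: infinite_finite_induct)
    (auto intro: conj_closed_subfieldD[OF assms(1)])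

lemma conj_closed_subfield_scalar_prod:
  assumes "conj_closed_subfield F" and "u \<in> vecs_over F n" and "v \<in> vecs_over F n"
  shows "u \<bullet> v \<in> F"
  using assms(2,3) unfolding scalar_prod_def vecs_over_def
  by (auto intro!: conj_closed_subfield_sum conj_closed_subfieldD[OF assms(1)] assms(1))

lemma row_in_vecs_over: "A \<in> mats_over F m n \<Longrightarrow> i < m \<Longrightarrow> row A i \<in> vecs_over F n"
  by (auto simp: mats_over_def vecs_over_def)

lemma col_in_vecs_over: "A \<in> mats_over F m n \<Longrightarrow> j < n \<Longrightarrow> col A j \<in> vecs_over F m"
  by (auto simp: mats_over_def vecs_over_def)

lemma mult_in_mats_over:
  assumes "conj_closed_subfield F" and "A \<in> mats_over F k m" and "B \<in> mats_over F m n"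
  shows "A * B \<in> mats_over F k n"
proof -
  have "row A i \<bullet> col B j \<in> F" if "i < k" "j < n" for i j
    using conj_closed_subfield_scalar_prod[OF assms(1)] row_in_vecs_over[OF assms(2) that(1)]
      col_in_vecs_over[OF assms(3) that(2)] by blast
  then show ?thesis using assms(2,3) by (auto simp: mats_over_def)
qed

lemma mult_mat_vec_in_vecs_over:
  assumes "conj_closed_subfield F" and "A \<in> mats_over F m n" and "v \<in> vecs_over F n"
  shows "A *\<^sub>v v \<in> vecs_over F m"
proof -
  have "row A i \<bullet> v \<in> F" if "i < m" for i
    using conj_closed_subfield_scalar_prod[OF assms(1)] row_in_vecs_over[OF assms(2) that]
      assms(3) by blast
  then show ?thesis using assms(2,3) by (auto simp: mats_over_def vecs_over_def)
qed

lemma add_in_vecs_over: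
  assumes "conj_closed_subfield F" and "u \<in> vecs_over F n" and "v \<in> vecs_over F n"
  shows "u + v \<in> vecs_over F n"
  using assms(2,3) conj_closed_subfieldD(2)[OF assms(1)] by (auto simp: vecs_over_def)

lemma mat_adjoint_carrier: "A \<in> carrier_mat m n \<Longrightarrow> mat_adjoint A \<in> carrier_mat n m"
  by (auto simp: mat_adjoint_def)

text \<open>Turns the entries of \<open>A * mat_adjoint A\<close> into Hermitian products of rows of
  \<open>A\<close>.\<close>

lemma col_mat_adjoint:
  assumes "A \<in> carrier_mat m n" and "i < m"
  shows "col (mat_adjoint A) i = conjugate (row A i)"
  using assms by (intro eq_vecI) (auto simp: mat_adjoint_def mat_of_rows_index)

lemma mat_adjoint_in_mats_over:
  assumes "conj_closed_subfield F" and "A \<in> mats_over F m n"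
  shows "mat_adjoint A \<in> mats_over F n m"
  using assms(2) conj_closed_subfieldD(4)[OF assms(1)]
  by (auto simp: mats_over_def mat_adjoint_def mat_of_rows_index)

text \<open>Since \<open>v \<bullet>c v\<close> is real and nonnegative, passing to
  \<open>Re\<close> and the square root loses nothing. With \<open>r\<close> equal to 0 or 1, the
  norm conditions of quasi-orthonormality become equations between complex numbers.\<close>

lemma euclid_norm_eq_iff:
  assumes "r \<ge> 0"
  shows "euclid_norm v = r \<longleftrightarrow> v \<bullet>c v = complex_of_real (r\<^sup>2)"
proof -
  have "v \<bullet>c v \<ge> 0"
    by (rule conjugate_square_ge_0_vec)
  \<comment> \<open>In the order on the complex numbers, being above 0 includes having imaginary
    part 0.\<close>
  then have "Re (v \<bullet>c v) \<ge> 0" and "Im (v \<bullet>c v) = 0"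
    by (auto simp: less_eq_complex_def)
  moreover have "sqrt x = r \<longleftrightarrow> x = r\<^sup>2" if "x \<ge> 0" for x
    using that assms by (auto simp: real_sqrt_unique)
  ultimately show ?thesis
    by (simp add: euclid_norm_def complex_eq_iff)
qed

text \<open>Left multiplication by the Gram matrix of the rows scales each row by its own squared
  norm: a unit row is kept, and the factor 0 only meets a row that is already zero.\<close>

lemma quasi_orthonormal_rows_mult_adjoint:
  assumes A: "A \<in> carrier_mat m n" and qo: "quasi_orthonormal (rows A)"
  shows "A * mat_adjoint A * A = A"
proof -
  let ?G = "A * mat_adjoint A"
  have Gc: "?G \<in> carrier_mat m m"
    using A mat_adjoint_carrier[OF A] by auto
  have G: "?G $$ (i, j) = row A i \<bullet>c row A j" if "i < m" "j < m" for i j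
    using that A mat_adjoint_carrier[OF A] col_mat_adjoint[OF A that(2)] by simp
  \<comment> \<open>Definiteness of the Hermitian product turns norm 0 into the zero vector.\<close>
  have unit_or_zero: "row A i \<bullet>c row A i = 1 \<or> row A i = 0\<^sub>v n" if i: "i < m" for i
  proof -
    have "row A i \<in> set (rows A)"
      using i A by (auto simp: rows_def)
    then have "euclid_norm (row A i) = 1 \<or> euclid_norm (row A i) = 0"
      using qo by (auto simp: quasi_orthonormal_def)
    then show ?thesis
      using conjugate_square_eq_0_vec[of "row A i" n] A i
      by (auto simp: euclid_norm_eq_iff)
  qed
  \<comment> \<open>Quasi-orthonormality speaks only of pairs of unit rows. A pair containing a zero
    row is orthogonal trivially, and in every other pair both rows have norm 1 by
    \<open>unit_or_zero\<close>.\<close>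
  have orth: "row A i \<bullet>c row A j = 0" if ij: "i < m" "j < m" "i \<noteq> j" for i j
  proof (cases "row A i = 0\<^sub>v n \<or> row A j = 0\<^sub>v n")
    case True
    then show ?thesis using A ij by auto
  next
    case False
    then have "euclid_norm (rows A ! i) = 1" "euclid_norm (rows A ! j) = 1"
      using unit_or_zero ij A by (auto simp: euclid_norm_eq_iff)
    then show ?thesis
      using qo ij A by (auto simp: quasi_orthonormal_def)
  qed
  show ?thesis
  proof (rule eq_matI)
    fix i j assume "i < dim_row A" "j < dim_col A"
    then have i: "i < m" and j: "j < n" using A by auto
    have "(?G * A) $$ (i, j) = (\<Sum>k<m. ?G $$ (i, k) * A $$ (k, j))"
      using i j A Gc by (auto simp: scalar_prod_def atLeast0LessThan)
    \<comment> \<open>The Gram matrix is diagonal by \<open>orth\<close>, so only the summand at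
      \<open>k = i\<close> survives.\<close>
    also have "\<dots> = (\<Sum>k<m. if k = i then ?G $$ (i, i) * A $$ (i, j) else 0)"
      using i by (intro sum.cong) (auto simp: G orth)
    also have "\<dots> = row A i \<bullet>c row A i * A $$ (i, j)"
      using i by (simp add: G)
    also have "\<dots> = A $$ (i, j)"
      using unit_or_zero[OF i]
    proof
      \<comment> \<open>Here the scaling factor is 0 instead of 1, but the entry being scaled is 0
        as well.\<close>
      assume "row A i = 0\<^sub>v n"
      moreover have "A $$ (i, j) = row A i $ j"
        using i j A by simp
      ultimately show ?thesis using j by simp
    qed simp
    finally show "(?G * A) $$ (i, j) = A $$ (i, j)" .
  qed (use A Gc in auto)
qed

lemma invertible_mat_mult_vec_cancel:
  fixes M :: "'a :: comm_ring_1 mat"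
  assumes "invertible_mat M" and M: "M \<in> carrier_mat m m"
    and u: "u \<in> carrier_vec m" and v: "v \<in> carrier_vec m"
    and eq: "M *\<^sub>v u = M *\<^sub>v v"
  shows "u = v"
proof -
  obtain B where MB: "M * B = 1\<^sub>m m" and BM: "B * M = 1\<^sub>m (dim_row B)"
    using assms(1) M by (auto simp: invertible_mat_def inverts_mat_def)
  \<comment> \<open>\<open>inverts_mat\<close> sizes each identity by the left factor, which leaves
    the shape of \<open>B\<close> open; comparing column dimensions in the two inverse equations
    fixes it.\<close>
  have "dim_col B = m"
    using arg_cong[OF MB, of dim_col] by simp
  moreover have r: "dim_row B = m"
    using arg_cong[OF BM, of dim_col] M by simp
  ultimately have B: "B \<in> carrier_mat m m" by auto
  have "B *\<^sub>v (M *\<^sub>v w) = w" if "w \<in> carrier_vec m" for w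
    using assoc_mult_mat_vec[OF B M that] BM r that by simp
  then show ?thesis using u v eq by metis
qed

theorem mainTheorem1:
  fixes F :: "complex set"
    and m n :: nat
    and A M :: "complex mat"
    and b :: "complex vec"
  assumes "conj_closed_subfield F"
    and "A \<in> mats_over F m n"
    and "b \<in> vecs_over F m"
    and "\<exists>x\<in>vecs_over F n. A *\<^sub>v x = b"
    and "M \<in> mats_over F m m"
    and "invertible_mat M"
    and "quasi_orthonormal (rows (M * A))"
  shows "\<forall>x\<^sub>h\<in>vecs_over F n. A *\<^sub>v x\<^sub>h = 0\<^sub>v m \<longrightarrow>
    (let A' = M * A; b' = M *\<^sub>v b; x = mat_adjoint A' *\<^sub>v b' + x\<^sub>h
     in x \<in> vecs_over F n \<and> A *\<^sub>v x = b)"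
proof (intro ballI impI)
  fix x\<^sub>h assume xh: "x\<^sub>h \<in> vecs_over F n" and A_xh: "A *\<^sub>v x\<^sub>h = 0\<^sub>v m"
  define A' where "A' = M * A"
  \<comment> \<open>The particular solution; \<open>x\<^sub>h\<close> is added only at the end, by
    linearity.\<close>
  define y where "y = mat_adjoint A' *\<^sub>v (M *\<^sub>v b)"
  obtain x0 where x0: "x0 \<in> vecs_over F n" and A_x0: "A *\<^sub>v x0 = b"
    using assms(4) by blast
  have A'F: "A' \<in> mats_over F m n"
    unfolding A'_def by (rule mult_in_mats_over[OF assms(1,5,2)])
  have yF: "y \<in> vecs_over F n"
    unfolding y_def using assms(1,3,5) A'F
    by (blast intro: mult_mat_vec_in_vecs_over mat_adjoint_in_mats_over)
  have car: "A \<in> carrier_mat m n" "M \<in> carrier_mat m m" "A' \<in> carrier_mat m n"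
    "mat_adjoint A' \<in> carrier_mat n m" "x0 \<in> carrier_vec n" "x\<^sub>h \<in> carrier_vec n"
    "b \<in> carrier_vec m" "y \<in> carrier_vec n"
    using assms(2,3,5) A'F x0 xh yF mat_adjoint_carrier[of A' m n]
    by (auto simp: mats_over_def vecs_over_def)
  \<comment> \<open>This is where consistency enters: it puts \<open>M *\<^sub>v b\<close> in the
    range of \<open>A'\<close>, on which \<open>A' * mat_adjoint A'\<close> acts as the
    identity.\<close>
  have Mb: "M *\<^sub>v b = A' *\<^sub>v x0"
    using A_x0 assoc_mult_mat_vec[OF car(2,1,5)] by (simp add: A'_def)
  \<comment> \<open>The equation for \<open>y\<close> is checked after applying \<open>M\<close>,
    because only \<open>A' = M * A\<close> has quasi-orthonormal rows.\<close>
  have "M *\<^sub>v (A *\<^sub>v y) = A' *\<^sub>v y"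
    using assoc_mult_mat_vec[OF car(2,1,8)] by (simp add: A'_def)
  also have "\<dots> = A' * mat_adjoint A' *\<^sub>v (A' *\<^sub>v x0)"
    unfolding y_def Mb by (rule assoc_mult_mat_vec[OF car(3,4), symmetric]) (use car in auto)
  also have "\<dots> = A' * mat_adjoint A' * A' *\<^sub>v x0"
    by (rule assoc_mult_mat_vec[symmetric, of _ m m]) (use car in auto)
  also have "\<dots> = M *\<^sub>v b"
    using quasi_orthonormal_rows_mult_adjoint[OF car(3)] assms(7) Mb by (simp add: A'_def)
  finally have "A *\<^sub>v y = b"
    using invertible_mat_mult_vec_cancel[OF assms(6) car(2)] car by auto
  then have "A *\<^sub>v (y + x\<^sub>h) = b"
    using mult_add_distrib_mat_vec[OF car(1,8,6)] A_xh car by simp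
  then show "let A' = M * A; b' = M *\<^sub>v b; x = mat_adjoint A' *\<^sub>v b' + x\<^sub>h
     in x \<in> vecs_over F n \<and> A *\<^sub>v x = b"
    using add_in_vecs_over[OF assms(1) yF xh] by (simp add: y_def A'_def Let_def)
qed

end
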